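(* Let $\mathcal{X}\subseteq\mathbb{R}^n$ be nonempty and compact with $\lVert x\rVert_2\le M$ for every $x\in\mathcal{X}$. Let $Q\succeq0$ be a symmetric $n\times n$ matrix with eigenvalues $\lambda_1(Q)\ge\cdots\ge\lambda_n(Q)\ge0$, and let $\operatorname{opt}_Q=\max_{x\in\mathcal{X}}x^{\mathsf T}Qx$. For $0\le r<n$, let $Q_r$ be the rank-$r$ leading spectral truncation of $Q$, let $v_r=\max_{x\in\mathcal{X}}x^{\mathsf T}Q_rx$, let $\mathcal{C}_r\subseteq\mathcal{X}$ be a finite candidate set containing at least one maximizer of $x^{\mathsf T}Q_rx$ over $\mathcal{X}$, and let $\widehat x_r$ maximize $x^{\mathsf T}Qx$ over $\mathcal{C}_r$. Then $$L_r:=\widehat x_r^{\mathsf T}Q\widehat x_r\le\operatorname{opt}_Q\le U_r:=v_r+M^2\lambda_{r+1}(Q).$$ Consequently, increasing $r$ until $U_r-L_r$ meets a desired tolerance gives a certified rank-adaptive algorithm (when $U_r-L_r\le\eta$, the point $\widehat x_r$ is within $\eta$ of optimal), where for $r=n$ one sets $Q_n=Q$ and $U_n=L_n=v_n=\operatorname{opt}_Q$. Exactness is recovered earlier, at any $r<n$ with $\lambda_{r+1}(Q)=0$ (there $U_r=L_r=\operatorname{opt}_Q$).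
   Context: The leading spectral truncation is $Q_r=\sum_{i=1}^r\lambda_i(Q)u_iu_i^{\mathsf T}$, where $u_1,\dots,u_n$ is an orthonormal eigenbasis of $Q$ with $Qu_i=\lambda_i(Q)u_i$ (so $Q_0=0$). In the paper $\mathcal{C}_r$ is the finite candidate set produced by an exact enumeration method for $\max_{x\in\mathcal{X}}x^{\mathsf T}Q_rx$; the only property used is that it is a finite subset of $\mathcal{X}$ containing an exact maximizer. *)

theory Defs
  imports "HOL-Analysis.Analysis"
begin

definition quad_form :: "real^'n^'n \<Rightarrow> real^'n \<Rightarrow> real" where
  "quad_form A x = x \<bullet> (A *v x)"

definition pos_semidef :: "real^'n^'n \<Rightarrow> bool" where
  "pos_semidef A \<longleftrightarrow> transpose A = A \<and> (\<forall>x. 0 \<le> quad_form A x)"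

text \<open>The basis is indexed by \<open>1, \<dots>, CARD('n)\<close>; the values of \<open>lam\<close> and \<open>u\<close> outside this
  range are irrelevant. Ordering makes \<open>lam i\<close> on this range the \<open>i\<close>-th largest eigenvalue of
  \<open>Q\<close>, counted with multiplicity.\<close>

definition sorted_eigenbasis :: "real^'n^'n \<Rightarrow> (nat \<Rightarrow> real) \<Rightarrow> (nat \<Rightarrow> real^'n) \<Rightarrow> bool" where
  "sorted_eigenbasis Q lam u \<longleftrightarrow>
     (\<forall>i\<in>{1..CARD('n)}. \<forall>j\<in>{1..CARD('n)}. u i \<bullet> u j = (if i = j then 1 else 0)) \<and>
     (\<forall>i\<in>{1..CARD('n)}. Q *v u i = lam i *\<^sub>R u i) \<and>
     (\<forall>i\<in>{1..CARD('n)}. \<forall>j\<in>{1..CARD('n)}. i \<le> j \<longrightarrow> lam j \<le> lam i)"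

definition outer_self :: "real^'n \<Rightarrow> real^'n^'n" where
  "outer_self v = (\<chi> i j. v $ i * v $ j)"

definition leading_truncation :: "(nat \<Rightarrow> real) \<Rightarrow> (nat \<Rightarrow> real^'n) \<Rightarrow> nat \<Rightarrow> real^'n^'n" where
  "leading_truncation lam u r = (\<Sum>i=1..r. lam i *\<^sub>R outer_self (u i))"

text \<open>A genuine maximum: it is the intended value only when the maximum is attained.\<close>

definition max_over :: "('a \<Rightarrow> real) \<Rightarrow> 'a set \<Rightarrow> real" where
  "max_over f X = (GREATEST y. y \<in> f ` X)"

abbreviation maximizer_on :: "('a \<Rightarrow> real) \<Rightarrow> 'a set \<Rightarrow> 'a \<Rightarrow> bool" where
  "maximizer_on f X \<equiv> is_arg_max f (\<lambda>x. x \<in> X)"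

definition candidate_set :: "(real^'n) set \<Rightarrow> real^'n^'n \<Rightarrow> (real^'n) set \<Rightarrow> bool" where
  "candidate_set X A C \<longleftrightarrow> finite C \<and> C \<subseteq> X \<and> (\<exists>x\<in>C. maximizer_on (quad_form A) X x)"

definition opt_val :: "real^'n^'n \<Rightarrow> (real^'n) set \<Rightarrow> real" where
  "opt_val Q X = max_over (quad_form Q) X"

definition trunc_val :: "(real^'n) set \<Rightarrow> (nat \<Rightarrow> real) \<Rightarrow> (nat \<Rightarrow> real^'n) \<Rightarrow> nat \<Rightarrow> real" where
  "trunc_val X lam u r = max_over (quad_form (leading_truncation lam u r)) X"

text \<open>At full rank there is no eigenvalue \<open>lam (r + 1)\<close>; the upper bound is then the optimum
  by convention. Correspondingly, the lower bound is the optimum at full rank when \<open>xhat\<close> is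
  taken there to be an exact maximizer.\<close>

definition upper_bd ::
  "(real^'n) set \<Rightarrow> real^'n^'n \<Rightarrow> real \<Rightarrow> (nat \<Rightarrow> real) \<Rightarrow> (nat \<Rightarrow> real^'n) \<Rightarrow> nat \<Rightarrow> real" where
  "upper_bd X Q M lam u r =
     (if r < CARD('n) then trunc_val X lam u r + M\<^sup>2 * lam (r + 1) else opt_val Q X)"

definition lower_bd :: "real^'n^'n \<Rightarrow> (nat \<Rightarrow> real^'n) \<Rightarrow> nat \<Rightarrow> real" where
  "lower_bd Q xhat r = quad_form Q (xhat r)"

text \<open>The rank at which the rank-adaptive algorithm stops: the first one whose certified gap
  meets the tolerance.\<close>

definition stopping_rank ::
  "(real^'n) set \<Rightarrow> real^'n^'n \<Rightarrow> real \<Rightarrow> (nat \<Rightarrow> real) \<Rightarrow> (nat \<Rightarrow> real^'n) \<Rightarrow> (nat \<Rightarrow> real^'n)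
     \<Rightarrow> real \<Rightarrow> nat" where
  "stopping_rank X Q M lam u xhat \<eta> =
     (LEAST r. upper_bd X Q M lam u r - lower_bd Q xhat r \<le> \<eta>)"

lemma max_over_eq:
  assumes "maximizer_on f X x"
  shows "max_over f X = f x"
  unfolding max_over_def
  using assms by (intro Greatest_equality) (auto simp: is_arg_max_linorder)

lemma ex_maximizer_quad_form:
  fixes X :: "(real^'n) set"
  assumes "compact X" "X \<noteq> {}"
  shows "\<exists>x. maximizer_on (quad_form A) X x"
proof -
  have "continuous_on X (quad_form A)"
    unfolding quad_form_def[abs_def]
    by (intro continuous_intros linear_continuous_on matrix_vector_mul_bounded_linear)
  from continuous_attains_sup[OF assms this] show ?thesis
    by (auto simp: is_arg_max_linorder)
qed

text \<open>Every symmetric matrix has a sorted eigenbasis (spectral theorem), so the assumption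
  \<open>sorted_eigenbasis Q lam u\<close> is never vacuous for symmetric \<open>Q\<close>.\<close>

lemma sym_inner:
  fixes Q :: "real^'n^'n"
  assumes "transpose Q = Q"
  shows "x \<bullet> (Q *v y) = y \<bullet> (Q *v x)"
  by (metis assms dot_lmul_matrix inner_commute transpose_matrix_vector)

lemma quadratic_nonpos_imp_linear_zero:
  fixes a b :: real
  assumes "\<And>t. 2 * t * a + t\<^sup>2 * b \<le> 0"
  shows "a = 0"
proof (rule ccontr)
  assume "a \<noteq> 0"
  define s where "s = 1 / (\<bar>b\<bar> + 1)"
  have s: "s > 0" "s * \<bar>b\<bar> < 1" by (auto simp: s_def field_simps)
  have "2 * (s * a) * a + (s * a)\<^sup>2 * b = s * a\<^sup>2 * (2 + s * b)"
    by (simp add: power2_eq_square algebra_simps)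
  moreover have "\<bar>s * b\<bar> < 1" using s by (simp add: abs_mult)
  hence "2 + s * b > 0" by linarith
  hence "s * a\<^sup>2 * (2 + s * b) > 0" using s \<open>a \<noteq> 0\<close> by (intro mult_pos_pos) auto
  ultimately show False using assms[of "s * a"] by simp
qed

lemma spectral_aux:
  fixes Q :: "real^'n^'n"
  assumes sym: "transpose Q = Q"
  shows "subspace S \<Longrightarrow> (\<And>x. x \<in> S \<Longrightarrow> Q *v x \<in> S) \<Longrightarrow> dim S = k \<Longrightarrow>
    \<exists>lam u. (\<forall>i\<in>{1..k}. u i \<in> S) \<and>
      (\<forall>i\<in>{1..k}. \<forall>j\<in>{1..k}. u i \<bullet> u j = (if i = j then 1 else 0)) \<and>
      (\<forall>i\<in>{1..k}. Q *v u i = lam i *\<^sub>R u i) \<and>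
      (\<forall>i\<in>{1..k}. \<forall>j\<in>{1..k}. i \<le> j \<longrightarrow> lam j \<le> (lam i :: real))"
proof (induction k arbitrary: S)
  case 0
  then show ?case by simp
next
  case (Suc k)
  let ?B = "S \<inter> sphere 0 1"
  obtain z where z: "z \<in> S" "z \<noteq> 0" using Suc.prems(3) dim_eq_0[of S] by auto
  have "(1 / norm z) *\<^sub>R z \<in> ?B"
    using z Suc.prems(1) by (auto intro: subspace_scale)
  hence ne: "?B \<noteq> {}" by blast
  have "compact ?B"
    by (metis Suc.prems(1) closed_Int_compact closed_subspace compact_sphere)
  from ex_maximizer_quad_form[OF this ne, of Q]
  obtain v where v: "v \<in> S" "norm v = 1" and
    vmax: "\<And>y. y \<in> S \<Longrightarrow> norm y = 1 \<Longrightarrow> quad_form Q y \<le> quad_form Q v"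
    by (auto simp: is_arg_max_linorder)
  define l where "l = quad_form Q v"
  have vv: "v \<bullet> v = 1" using v by (simp add: dot_square_norm)
  have ray: "quad_form Q y \<le> l * (y \<bullet> y)" if "y \<in> S" for y
  proof (cases "y = 0")
    case True then show ?thesis by (simp add: quad_form_def)
  next
    case False
    have "quad_form Q ((1 / norm y) *\<^sub>R y) \<le> l"
      unfolding l_def using that False Suc.prems(1) by (intro vmax) (auto intro: subspace_scale)
    also have "quad_form Q ((1 / norm y) *\<^sub>R y) = quad_form Q y / (norm y)\<^sup>2"
      by (simp add: quad_form_def matrix_vector_mult_scaleR power2_eq_square)
    finally show ?thesis using False by (simp add: divide_simps dot_square_norm)
  qed
  have orth: "w \<bullet> (Q *v v) = 0" if w: "w \<in> S" "w \<bullet> v = 0" for w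
  proof (rule quadratic_nonpos_imp_linear_zero)
    fix t :: real
    have "v + t *\<^sub>R w \<in> S" using Suc.prems(1) v w by (auto intro: subspace_add subspace_scale)
    from ray[OF this] show "2 * t * (w \<bullet> (Q *v v)) + t\<^sup>2 * (quad_form Q w - l * (w \<bullet> w)) \<le> 0"
      using w vv sym_inner[OF sym, of v w]
      by (simp add: quad_form_def matrix_vector_right_distrib matrix_vector_mult_scaleR
          inner_add_left inner_add_right inner_commute[of v w] l_def[unfolded quad_form_def]
          power2_eq_square algebra_simps)
  qed
  have Qv: "Q *v v = l *\<^sub>R v"
  proof -
    let ?w = "Q *v v - l *\<^sub>R v"
    have wS: "?w \<in> S" using Suc.prems v by (auto intro: subspace_diff subspace_scale)
    have wv: "?w \<bullet> v = 0"
      using vv by (simp add: inner_diff_left inner_diff_right l_def quad_form_def inner_commute)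
    have "?w \<bullet> ?w = 0" using orth[OF wS wv] wv by (simp add: inner_diff_right)
    thus ?thesis by simp
  qed
  let ?T = "{y \<in> S. \<forall>x\<in>span {v}. orthogonal x y}"
  have Teq: "?T = {y \<in> S. v \<bullet> y = 0}"
    by (auto simp: orthogonal_def span_singleton)
  have "dim ?T + dim (span {v}) = dim S"
    by (rule dim_subspace_orthogonal_to_vectors)
      (use Suc.prems(1) v in \<open>auto simp: span_minimal\<close>)
  moreover have "v \<noteq> 0" using vv by auto
  hence "dim (span {v}) = 1" by (simp add: dim_singleton)
  ultimately have dT: "dim ?T = k" using Suc.prems(3) by simp
  have sT: "subspace ?T"
    unfolding Teq using Suc.prems(1) by (auto simp: subspace_def inner_add_right)
  have iT: "Q *v x \<in> ?T" if "x \<in> ?T" for x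
    using that Suc.prems(2) sym_inner[OF sym, of v x] unfolding Teq
    by (auto simp: Qv inner_commute)
  from Suc.IH[OF sT iT dT] obtain lam u where
    a: "\<forall>i\<in>{1..k}. u i \<in> ?T" and
    b: "\<forall>i\<in>{1..k}. \<forall>j\<in>{1..k}. u i \<bullet> u j = (if i = j then 1 else 0)" and
    c: "\<forall>i\<in>{1..k}. Q *v u i = lam i *\<^sub>R u i" and
    d: "\<forall>i\<in>{1..k}. \<forall>j\<in>{1..k}. i \<le> j \<longrightarrow> lam j \<le> (lam i :: real)"
    by blast
  have le: "lam i \<le> l" if "i \<in> {1..k}" for i
  proof -
    have "u i \<in> S" using a that by auto
    from ray[OF this] show ?thesis using b c that by (auto simp: quad_form_def)
  qed
  define lam' where "lam' i = (if i = 1 then l else lam (i - 1))" for i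
  define u' where "u' i = (if i = 1 then v else u (i - 1))" for i
  have cases: "i = 1 \<or> i \<noteq> 1 \<and> i - 1 \<in> {1..k}" if "i \<in> {1..Suc k}" for i
    using that by auto
  have vu: "v \<bullet> u i = 0" "u i \<bullet> v = 0" "u i \<in> S" if "i \<in> {1..k}" for i
    using a that unfolding Teq by (auto simp: inner_commute)
  have "\<forall>i\<in>{1..Suc k}. u' i \<in> S"
    using cases v(1) vu(3) by (auto simp del: atLeastAtMost_iff simp: u'_def)
  moreover have "\<forall>i\<in>{1..Suc k}. Q *v u' i = lam' i *\<^sub>R u' i"
    using cases c Qv by (auto simp del: atLeastAtMost_iff simp: u'_def lam'_def)
  moreover have "u' i \<bullet> u' j = (if i = j then 1 else 0)"
    if "i \<in> {1..Suc k}" "j \<in> {1..Suc k}" for i j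
    using cases[OF that(1)] cases[OF that(2)]
  proof (elim disjE conjE)
    assume ij: "i \<noteq> 1" "j \<noteq> 1" "i - 1 \<in> {1..k}" "j - 1 \<in> {1..k}"
    hence "i - 1 = j - 1 \<longleftrightarrow> i = j" by auto
    thus ?thesis using b ij unfolding u'_def by simp
  qed (use vu vv in \<open>auto simp del: atLeastAtMost_iff simp: u'_def\<close>)
  moreover have "lam' j \<le> lam' i"
    if "i \<in> {1..Suc k}" "j \<in> {1..Suc k}" "i \<le> j" for i j
    using cases[OF that(1)] cases[OF that(2)]
  proof (elim disjE conjE)
    assume ij: "i \<noteq> 1" "j \<noteq> 1" "i - 1 \<in> {1..k}" "j - 1 \<in> {1..k}"
    moreover have "i - 1 \<le> j - 1" using that(3) by simp
    ultimately show ?thesis using d unfolding lam'_def by simp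
  qed (use le that in \<open>auto simp: lam'_def\<close>)
  ultimately show ?case by blast
qed

lemma ex_sorted_eigenbasis:
  fixes Q :: "real^'n^'n"
  assumes "transpose Q = Q"
  shows "\<exists>lam u. sorted_eigenbasis Q lam u"
  using spectral_aux[OF assms, of UNIV "CARD('n)"]
  unfolding sorted_eigenbasis_def by (auto simp: subspace_UNIV dim_UNIV)

end

theory Submission
  imports Defs
begin

text \<open>In the eigenbasis, \<open>x\<^sup>T Q x - x\<^sup>T Q\<^sub>r x = \<Sum>\<^sub>i\<^sub>>\<^sub>r \<lambda>\<^sub>i \<langle>u\<^sub>i, x\<rangle>\<^sup>2\<close>, and by Parseval this tail
  lies below \<open>\<lambda>\<^sub>r\<^sub>+\<^sub>1 \<parallel>x\<parallel>\<^sup>2 \<le> M\<^sup>2 \<lambda>\<^sub>r\<^sub>+\<^sub>1\<close>. Evaluating at a maximizer of \<open>Q\<close> gives the upper bound.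
  If \<open>\<lambda>\<^sub>r\<^sub>+\<^sub>1 = 0\<close>, the tail vanishes, so \<open>Q\<^sub>r = Q\<close> and the candidates contain a maximizer of \<open>Q\<close>.\<close>

lemma outer_self_mult: "outer_self v *v x = (v \<bullet> x) *\<^sub>R v"
  by (simp add: outer_self_def vec_eq_iff matrix_vector_mult_def inner_vec_def
      sum_distrib_left mult_ac)

lemma leading_truncation_mult:
  "leading_truncation lam u r *v x = (\<Sum>i=1..r. lam i *\<^sub>R (u i \<bullet> x) *\<^sub>R u i)"
  unfolding leading_truncation_def
  by (induction r) (auto simp: matrix_vector_mult_add_rdistrib outer_self_mult
      simp flip: scaleR_matrix_vector_assoc)

text \<open>Diagonal form in the coordinates \<open>u i \<bullet> x\<close>. It needs no
  orthonormality, since each rank-one term contributes its own square.\<close>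

lemma quad_form_leading_truncation:
  "quad_form (leading_truncation lam u r) x = (\<Sum>i=1..r. lam i * (u i \<bullet> x)\<^sup>2)"
  unfolding quad_form_def leading_truncation_mult
  by (simp add: inner_sum_right power2_eq_square inner_commute mult.assoc)

lemma max_over_ge:
  assumes "maximizer_on f X z" "x \<in> X"
  shows "f x \<le> max_over f X"
  using assms by (simp add: max_over_eq[OF assms(1)] is_arg_max_linorder)

context
  fixes Q :: "real^'n^'n" and lam :: "nat \<Rightarrow> real" and u :: "nat \<Rightarrow> real^'n"
  assumes eb: "sorted_eigenbasis Q lam u"
begin

lemma eigenbasis_inner:
  "i \<in> {1..CARD('n)} \<Longrightarrow> j \<in> {1..CARD('n)} \<Longrightarrow> u i \<bullet> u j = (if i = j then 1 else 0)"
  using eb unfolding sorted_eigenbasis_def by blast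

lemma eigenbasis_mult: "i \<in> {1..CARD('n)} \<Longrightarrow> Q *v u i = lam i *\<^sub>R u i"
  using eb unfolding sorted_eigenbasis_def by blast

lemma eigenvalue_antimono: "1 \<le> i \<Longrightarrow> i \<le> j \<Longrightarrow> j \<le> CARD('n) \<Longrightarrow> lam j \<le> lam i"
  using eb unfolding sorted_eigenbasis_def by simp

text \<open>Orthonormal vectors are independent, and \<open>CARD('n)\<close> of them span the space
  by a dimension count. The expansion is first obtained over the set of basis vectors and then
  pulled back to indices.\<close>

lemma eigenbasis_expansion: "(\<Sum>i=1..CARD('n). (u i \<bullet> x) *\<^sub>R u i) = x"
proof -
  let ?I = "{1..CARD('n)}"
  \<comment> \<open>If two distinct indices gave the same vector, its inner product with itself
    would be both 1 and 0.\<close>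
  have inj: "inj_on u ?I"
    by (rule inj_onI) (metis eigenbasis_inner zero_neq_one)
  have orth: "pairwise orthogonal (u ` ?I)"
    by (auto simp: pairwise_def orthogonal_def eigenbasis_inner simp del: atLeastAtMost_iff)
  have norm1: "norm b = 1" if "b \<in> u ` ?I" for b
    using that by (auto simp: norm_eq_1 eigenbasis_inner simp del: atLeastAtMost_iff)
  have "independent (u ` ?I)"
    using norm1 by (intro pairwise_orthogonal_independent orth) force
  moreover have "card (u ` ?I) = DIM(real^'n)"
    using card_image[OF inj] by simp
  ultimately have x: "x \<in> span (u ` ?I)"
    using card_ge_dim_independent[of "u ` ?I" UNIV] by (auto simp: dim_UNIV)
  have "(\<Sum>b\<in>u ` ?I. (b \<bullet> x) *\<^sub>R b) = x"
    using orthonormal_basis_expand[OF orth norm1 x] by (simp add: inner_commute[of x])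
  then show ?thesis
    by (simp only: sum.reindex[OF inj] o_def)
qed

lemma eigenbasis_parseval: "(\<Sum>i=1..CARD('n). (u i \<bullet> x)\<^sup>2) = (norm x)\<^sup>2"
proof -
  have "(norm x)\<^sup>2 = x \<bullet> (\<Sum>i=1..CARD('n). (u i \<bullet> x) *\<^sub>R u i)"
    by (simp only: eigenbasis_expansion power2_norm_eq_inner)
  then show ?thesis
    by (simp add: inner_sum_right power2_eq_square inner_commute)
qed

text \<open>Both matrices scale each \<open>u i\<close> by \<open>lam i\<close>, and every vector is
  a combination of these. Viewing \<open>Q\<close> as its own full truncation makes the diagonal
  formula available for \<open>quad_form Q\<close>.\<close>

lemma leading_truncation_full: "leading_truncation lam u CARD('n) = Q"
proof -
  have "leading_truncation lam u CARD('n) *v x = Q *v x" for x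
  proof -
    have "Q *v x = Q *v (\<Sum>i=1..CARD('n). (u i \<bullet> x) *\<^sub>R u i)"
      by (simp only: eigenbasis_expansion)
    also have "\<dots> = (\<Sum>i=1..CARD('n). (u i \<bullet> x) *\<^sub>R (Q *v u i))"
      by (simp add: linear_sum[OF matrix_vector_mul_linear] matrix_vector_mult_scaleR)
    also have "\<dots> = (\<Sum>i=1..CARD('n). lam i *\<^sub>R (u i \<bullet> x) *\<^sub>R u i)"
      by (intro sum.cong refl) (simp add: eigenbasis_mult mult.commute del: atLeastAtMost_iff)
    finally show ?thesis
      by (simp add: leading_truncation_mult)
  qed
  then show ?thesis
    by (simp add: matrix_eq)
qed

text \<open>At a unit eigenvector the quadratic form equals the eigenvalue.\<close>

lemma eigenvalue_nonneg:
  assumes "pos_semidef Q" "i \<in> {1..CARD('n)}"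
  shows "0 \<le> lam i"
proof -
  have "0 \<le> quad_form Q (u i)"
    using assms(1) by (simp add: pos_semidef_def)
  also have "quad_form Q (u i) = lam i"
    using assms(2) by (simp add: quad_form_def eigenbasis_mult eigenbasis_inner
        del: atLeastAtMost_iff)
  finally show ?thesis .
qed

lemma quad_form_le_truncation:
  assumes psd: "pos_semidef Q" and r: "r < CARD('n)"
  shows "quad_form Q x \<le> quad_form (leading_truncation lam u r) x + lam (r + 1) * (norm x)\<^sup>2"
proof -
  have split: "{1..CARD('n)} = {1..r} \<union> {r+1..CARD('n)}"
    using r by auto
  have "(\<Sum>i=r+1..CARD('n). lam i * (u i \<bullet> x)\<^sup>2) \<le> (\<Sum>i=r+1..CARD('n). lam (r+1) * (u i \<bullet> x)\<^sup>2)"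
    by (intro sum_mono mult_right_mono eigenvalue_antimono) auto
  \<comment> \<open>Adding the first \<open>r\<close> terms only increases the sum because
    \<open>lam (r+1)\<close> is nonnegative; Parseval then applies to the full range.\<close>
  also have "\<dots> \<le> (\<Sum>i=1..CARD('n). lam (r+1) * (u i \<bullet> x)\<^sup>2)"
    using eigenvalue_nonneg[OF psd, of "r+1"] r by (intro sum_mono2) auto
  also have "\<dots> = lam (r+1) * (norm x)\<^sup>2"
    by (simp only: eigenbasis_parseval flip: sum_distrib_left)
  finally have "(\<Sum>i=r+1..CARD('n). lam i * (u i \<bullet> x)\<^sup>2) \<le> lam (r+1) * (norm x)\<^sup>2" .
  moreover have "quad_form Q x = (\<Sum>i=1..CARD('n). lam i * (u i \<bullet> x)\<^sup>2)"
    using quad_form_leading_truncation[of lam u "CARD('n)" x] by (simp only: leading_truncation_full)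
  moreover have "\<dots> = (\<Sum>i=1..r. lam i * (u i \<bullet> x)\<^sup>2) + (\<Sum>i=r+1..CARD('n). lam i * (u i \<bullet> x)\<^sup>2)"
    unfolding split by (intro sum.union_disjoint) auto
  ultimately show ?thesis
    by (simp add: quad_form_leading_truncation)
qed

lemma leading_truncation_exact:
  assumes psd: "pos_semidef Q" and r: "r < CARD('n)" and zero: "lam (r + 1) = 0"
  shows "leading_truncation lam u r = Q"
proof -
  \<comment> \<open>The ordering and positive semidefiniteness squeeze \<open>lam i\<close> between
    0 and \<open>lam (r + 1) = 0\<close>.\<close>
  have "lam i = 0" if "i \<in> {1..CARD('n)} - {1..r}" for i
    using that eigenvalue_antimono[of "r+1" i] eigenvalue_nonneg[OF psd, of i] zero by auto
  then have "leading_truncation lam u r = leading_truncation lam u CARD('n)"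
    unfolding leading_truncation_def using r by (intro sum.mono_neutral_left) auto
  then show ?thesis
    by (simp only: leading_truncation_full)
qed

lemma opt_val_le_upper_bd:
  assumes "X \<noteq> {}" "compact X" "\<forall>x\<in>X. norm x \<le> M" "pos_semidef Q" and r: "r < CARD('n)"
  shows "opt_val Q X \<le> upper_bd X Q M lam u r"
proof -
  obtain z where z: "maximizer_on (quad_form Q) X z"
    using ex_maximizer_quad_form assms(1,2) by blast
  \<comment> \<open>The point \<open>w\<close> certifies that \<open>trunc_val\<close> is an
    attained maximum, so that it bounds the truncated form at \<open>z\<close>.\<close>
  obtain w where w: "maximizer_on (quad_form (leading_truncation lam u r)) X w"
    using ex_maximizer_quad_form assms(1,2) by blast
  have zX: "z \<in> X"
    using z by (simp add: is_arg_max_def)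
  have "opt_val Q X = quad_form Q z"
    unfolding opt_val_def by (rule max_over_eq[OF z])
  also have "\<dots> \<le> quad_form (leading_truncation lam u r) z + lam (r+1) * (norm z)\<^sup>2"
    by (rule quad_form_le_truncation[OF assms(4) r])
  \<comment> \<open>Replacing \<open>norm z\<close> by \<open>M\<close> uses
    \<open>0 \<le> lam (r+1)\<close> as well as \<open>norm z \<le> M\<close>.\<close>
  also have "\<dots> \<le> trunc_val X lam u r + lam (r+1) * M\<^sup>2"
    using max_over_ge[OF w zX] assms(3) zX eigenvalue_nonneg[OF assms(4), of "r+1"] r
    by (intro add_mono mult_left_mono power_mono) (auto simp: trunc_val_def)
  finally show ?thesis
    using r by (simp add: upper_bd_def mult.commute)
qed

end

theorem corollary7p2:
  fixes X :: "(real^'n) set"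
    and Q :: "real^'n^'n"
    and M :: real
    and lam :: "nat \<Rightarrow> real"
    and u :: "nat \<Rightarrow> real^'n"
    and C :: "nat \<Rightarrow> (real^'n) set"
    and xhat :: "nat \<Rightarrow> real^'n"
  assumes "X \<noteq> {}" and "compact X" and "\<forall>x\<in>X. norm x \<le> M"
    and "pos_semidef Q" and "sorted_eigenbasis Q lam u"
    and "\<forall>r<CARD('n). candidate_set X (leading_truncation lam u r) (C r)"
    and "\<forall>r<CARD('n). maximizer_on (quad_form Q) (C r) (xhat r)"
    and "maximizer_on (quad_form Q) X (xhat CARD('n))"
  shows "(\<forall>r<CARD('n). lower_bd Q xhat r \<le> opt_val Q X \<and> opt_val Q X \<le> upper_bd X Q M lam u r)
    \<and> leading_truncation lam u CARD('n) = Q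
    \<and> trunc_val X lam u CARD('n) = opt_val Q X
    \<and> upper_bd X Q M lam u CARD('n) = opt_val Q X
    \<and> lower_bd Q xhat CARD('n) = opt_val Q X
    \<and> (\<forall>\<eta>. \<forall>r\<le>CARD('n). upper_bd X Q M lam u r - lower_bd Q xhat r \<le> \<eta> \<longrightarrow>
          xhat r \<in> X \<and> opt_val Q X - \<eta> \<le> quad_form Q (xhat r))
    \<and> (\<forall>\<eta>\<ge>0. let s = stopping_rank X Q M lam u xhat \<eta> in
          s \<le> CARD('n) \<and> upper_bd X Q M lam u s - lower_bd Q xhat s \<le> \<eta> \<and>
          xhat s \<in> X \<and> opt_val Q X - \<eta> \<le> quad_form Q (xhat s))
    \<and> (\<forall>r<CARD('n). lam (r + 1) = 0 \<longrightarrow>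
          upper_bd X Q M lam u r = opt_val Q X \<and> lower_bd Q xhat r = opt_val Q X)"
proof -
  let ?n = "CARD('n)"
  let ?U = "upper_bd X Q M lam u" and ?L = "lower_bd Q xhat"
  note eb = assms(5)
  have xhat_in: "xhat r \<in> X" if "r \<le> ?n" for r
  proof (cases "r = ?n")
    case True
    then show ?thesis using assms(8) by (simp add: is_arg_max_def)
  next
    case False
    then show ?thesis
      using that assms(6,7) unfolding candidate_set_def is_arg_max_def
      by (meson in_mono le_neq_implies_less)
  qed
  \<comment> \<open>The full-rank point \<open>xhat CARD('n)\<close> witnesses that the optimum is
    attained, which serves every \<open>r\<close> at once.\<close>
  have lower: "?L r \<le> opt_val Q X" if "r \<le> ?n" for r
    unfolding lower_bd_def opt_val_def by (rule max_over_ge[OF assms(8) xhat_in[OF that]])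
  have upper: "opt_val Q X \<le> ?U r" if "r \<le> ?n" for r
    using that opt_val_le_upper_bd[OF eb assms(1-4), of r]
    by (cases "r = ?n") (auto simp: upper_bd_def)
  have L_full: "?L ?n = opt_val Q X"
    unfolding lower_bd_def opt_val_def by (rule max_over_eq[OF assms(8), symmetric])
  have U_full: "?U ?n = opt_val Q X"
    by (simp add: upper_bd_def)
  \<comment> \<open>The optimum minus \<eta> is at most \<open>?U r - \<eta>\<close>, which the gap
    condition puts below \<open>?L r\<close>.\<close>
  have certified: "xhat r \<in> X \<and> opt_val Q X - \<eta> \<le> quad_form Q (xhat r)"
    if "r \<le> ?n" "?U r - ?L r \<le> \<eta>" for \<eta> r
    using that upper[of r] xhat_in[of r] by (simp add: lower_bd_def)
  have stop: "let s = stopping_rank X Q M lam u xhat \<eta> in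
      s \<le> ?n \<and> ?U s - ?L s \<le> \<eta> \<and> xhat s \<in> X \<and> opt_val Q X - \<eta> \<le> quad_form Q (xhat s)"
    if "0 \<le> \<eta>" for \<eta>
  proof -
    \<comment> \<open>The gap is zero at full rank, so the \<open>LEAST\<close> in
      \<open>stopping_rank\<close> has a witness and is at most \<open>CARD('n)\<close>.\<close>
    have "?U ?n - ?L ?n \<le> \<eta>"
      using that by (simp add: U_full L_full)
    then have "stopping_rank X Q M lam u xhat \<eta> \<le> ?n"
      "?U (stopping_rank X Q M lam u xhat \<eta>) - ?L (stopping_rank X Q M lam u xhat \<eta>) \<le> \<eta>"
      unfolding stopping_rank_def
      using Least_le[of "\<lambda>r. ?U r - ?L r \<le> \<eta>"] LeastI[of "\<lambda>r. ?U r - ?L r \<le> \<eta>"] by blast+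
    then show ?thesis
      unfolding Let_def using certified by blast
  qed
  have exact: "?U r = opt_val Q X \<and> ?L r = opt_val Q X" if r: "r < ?n" "lam (r + 1) = 0" for r
  proof
    have Qr: "leading_truncation lam u r = Q"
      by (rule leading_truncation_exact[OF eb assms(4) r])
    show "?U r = opt_val Q X"
      using r by (simp add: upper_bd_def trunc_val_def opt_val_def Qr)
    \<comment> \<open>The point \<open>xhat r\<close> need not be \<open>c\<close>, but it does at
      least as well on \<open>C r\<close>, which closes the gap from below.\<close>
    obtain c where c: "c \<in> C r" "maximizer_on (quad_form Q) X c"
      using assms(6) r(1) unfolding candidate_set_def by (auto simp: Qr)
    have "opt_val Q X = quad_form Q c"
      unfolding opt_val_def by (rule max_over_eq[OF c(2)])
    also have "\<dots> \<le> ?L r"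
      using assms(7) r(1) c(1) by (simp add: lower_bd_def is_arg_max_linorder)
    finally show "?L r = opt_val Q X"
      using lower[of r] r(1) by simp
  qed
  note full = leading_truncation_full[OF eb]
  have "trunc_val X lam u ?n = opt_val Q X"
    by (simp only: trunc_val_def opt_val_def full)
  then show ?thesis
    using lower upper full U_full L_full certified stop exact
    by (intro conjI allI impI) (simp_all only: less_imp_le)
qed

end
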